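(* For every positive integer $r$, the following identity of formal power series holds: \[ \sum_{n\geq 0}\frac{u^n}{(t_1;q_1)_{n+1}(t_2;q_2)_{n+1}}\sum_{\gamma\in G(r,n)} t_1^{\mathrm{des}_G(\gamma)}t_2^{\mathrm{des}_G(\gamma^{-1})}q_1^{\mathrm{maj}(\gamma)}q_2^{\mathrm{maj}(\gamma^{-1})}a^{\mathrm{col}(\gamma)}b^{\mathrm{col}(\gamma^{-1})} =\sum_{k_1,k_2\geq 0}\frac{t_1^{k_1}t_2^{k_2}}{(u;q_1,q_2)_{k_1+1,k_2+1}\,(ab[r-1]_{a,b}u;q_1,q_2)_{k_1,k_2}}, \] where $[r-1]_{a,b}=\frac{a^{r-1}-b^{r-1}}{a-b}$.
   Context: Notation: $(x;q)_0=1$, $(x;q)_n=(1-x)(1-xq)\cdots(1-xq^{n-1})$; $(x;p,q)_{n,m}=1$ if $n=0$ or $m=0$, and otherwise $(x;p,q)_{n,m}=\prod_{1\le i\le n}\prod_{1\le j\le m}(1-xp^{i-1}q^{j-1})$. $G(r,n)$ is the set of $r$-colored permutations $\gamma=(c_1,\dots,c_n;\sigma)$ with $c_i\in\{0,\dots,r-1\}$, $\sigma\in S_n$, written $\gamma=[\gamma(1),\dots,\gamma(n)]=[\sigma(1)^{c_1},\dots,\sigma(n)^{c_n}]$ (exponent $0$ omitted). Its inverse is $\gamma^{-1}=(c'_1,\dots,c'_n;\sigma^{-1})$ where $c'_i=0$ if $c_{\sigma^{-1}(i)}=0$ and $c'_i=r-c_{\sigma^{-1}(i)}$ otherwise. Colored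 integers $x^c$ ($x^0=x$) are totally ordered by: uncolored integers in natural order; every $x^c$ with $c\ge1$ is smaller than every uncolored integer (including $0$); for $c,d\ge1$, $x^c<y^d$ iff $x>y$, or $x=y$ and $c>d$. $\mathrm{Des}_G(\gamma)=\{i\in\{0,\dots,n-1\}:\gamma(i)>\gamma(i+1)\}$ with $\gamma(0):=0$; $\mathrm{des}_G=|\mathrm{Des}_G|$; $\mathrm{maj}(\gamma)=\sum_{i\in\mathrm{Des}_G(\gamma)}i$; $\mathrm{col}(\gamma)=\sum_ic_i$. *)

theory Defs
  imports "HOL-Computational_Algebra.Formal_Power_Series" "HOL-Combinatorics.Permutations"
begin

unbundle fps_syntax

text \<open>
  Formal power series in the seven commuting indeterminates
  $u, t_1, t_2, q_1, q_2, a, b$ over an integral domain, as iterated univariate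
  series: the outermost layer is the one in $u$, the innermost the one in $b$.
\<close>

type_synonym 'k series = "'k fps fps fps fps fps fps fps"

definition X_u :: "'k::idom series" where
  "X_u = fps_X"

definition X_t1 :: "'k::idom series" where
  "X_t1 = fps_const fps_X"

definition X_t2 :: "'k::idom series" where
  "X_t2 = fps_const (fps_const fps_X)"

definition X_q1 :: "'k::idom series" where
  "X_q1 = fps_const (fps_const (fps_const fps_X))"

definition X_q2 :: "'k::idom series" where
  "X_q2 = fps_const (fps_const (fps_const (fps_const fps_X)))"

definition X_a :: "'k::idom series" where
  "X_a = fps_const (fps_const (fps_const (fps_const (fps_const fps_X))))"

definition X_b :: "'k::idom series" where
  "X_b = fps_const (fps_const (fps_const (fps_const (fps_const (fps_const fps_X)))))"

fun series_coeff :: "'k::idom series \<Rightarrow> nat \<times> nat \<times> nat \<times> nat \<times> nat \<times> nat \<times> nat \<Rightarrow> 'k" where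
  "series_coeff f (eu, et1, et2, eq1, eq2, ea, eb) =
     f $ eu $ et1 $ et2 $ eq1 $ eq2 $ ea $ eb"

text \<open>
  Infinite sums of series are coefficientwise: each monomial may occur in only finitely many
  summands. (The metric topology that the library puts on iterated series treats the inner
  layers as discrete, so a sum such as $\sum_k t_1^k$ does not converge in it.)
\<close>

definition has_formal_sum :: "('i \<Rightarrow> 'k::idom series) \<Rightarrow> 'k series \<Rightarrow> bool"
    (infix "has'_formal'_sum" 46) where
  "f has_formal_sum S \<longleftrightarrow>
     (\<forall>e. finite {i. series_coeff (f i) e \<noteq> 0} \<and>
          series_coeff S e = (\<Sum>i | series_coeff (f i) e \<noteq> 0. series_coeff (f i) e))"

text \<open>
  Division in an integral domain, for a nonzero divisor that divides the dividend. The library's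
  division of power series is only suitable when the coefficients form a division ring; on
  iterated series it does not return the quotient of $a^m - b^m$ by $a - b$.
\<close>

definition exact_div :: "'a::idom \<Rightarrow> 'a \<Rightarrow> 'a" (infixl "\<div>" 70) where
  "x \<div> y = (THE z. z * y = x)"

lemma exact_div_eqI:
  fixes x y z :: "'a::idom"
  assumes "y \<noteq> 0" "z * y = x"
  shows "x \<div> y = z"
  using assms unfolding exact_div_def by (intro the_equality) auto

lemma exact_div_mult:
  fixes x y :: "'a::idom"
  assumes "y \<noteq> 0" "y dvd x"
  shows "(x \<div> y) * y = x"
  using assms exact_div_eqI[of y _ x] by (auto simp: dvd_def mult.commute)

definition bracket :: "nat \<Rightarrow> 'a::idom \<Rightarrow> 'a \<Rightarrow> 'a" where
  "bracket m x y = (x ^ m - y ^ m) \<div> (x - y)"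

lemma bracket_mult:
  fixes x y :: "'a::idom"
  assumes "x \<noteq> y"
  shows "bracket m x y * (x - y) = x ^ m - y ^ m"
proof -
  have "x - y dvd x ^ m - y ^ m"
    by (metis dvd_triv_left power_diff_sumr2)
  then show ?thesis
    unfolding bracket_def using assms by (intro exact_div_mult) auto
qed

definition qpoch :: "'a::comm_ring_1 \<Rightarrow> 'a \<Rightarrow> nat \<Rightarrow> 'a" where
  "qpoch x q n = (\<Prod>i\<in>{1..n}. 1 - x * q ^ (i - 1))"

definition qpoch2 :: "'a::comm_ring_1 \<Rightarrow> 'a \<Rightarrow> 'a \<Rightarrow> nat \<Rightarrow> nat \<Rightarrow> 'a" where
  "qpoch2 x p q n m = (\<Prod>i\<in>{1..n}. \<Prod>j\<in>{1..m}. 1 - x * p ^ (i - 1) * q ^ (j - 1))"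

lemma X_a_neq_X_b: "(X_a :: 'k::idom series) \<noteq> X_b"
proof
  assume "(X_a :: 'k series) = X_b"
  then have "series_coeff (X_a :: 'k series) (0,0,0,0,0,1,0) = series_coeff X_b (0,0,0,0,0,1,0)"
    by simp
  then show False
    by (simp add: X_a_def X_b_def)
qed

lemma fps_is_unit:
  fixes f :: "'a::comm_ring_1 fps"
  assumes "f $ 0 dvd 1"
  shows "f dvd 1"
proof -
  obtain y where "f $ 0 * y = 1"
    using assms by (metis dvd_def)
  then have "f * fps_right_inverse f y = 1"
    by (rule fps_right_inverse)
  then show ?thesis
    by (metis dvd_triv_left)
qed

lemma prod_is_unit:
  fixes f :: "'i \<Rightarrow> 'a::comm_ring_1"
  assumes "\<And>i. i \<in> A \<Longrightarrow> f i dvd 1"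
  shows "prod f A dvd 1"
  using prod_dvd_prod[of A f "\<lambda>_. 1"] assms by simp

text \<open>The denominators that occur are units, so the corresponding quotients exist.\<close>

lemma qpoch_unit:
  "qpoch (X_t1 :: 'k::idom series) X_q1 n dvd 1" "qpoch (X_t2 :: 'k::idom series) X_q2 n dvd 1"
proof -
  have "1 - X_t1 * X_q1 ^ i dvd (1 :: 'k series)" for i
    by (intro fps_is_unit) (simp add: X_t1_def X_q1_def fps_const_power)
  moreover have "1 - X_t2 * X_q2 ^ i dvd (1 :: 'k series)" for i
    by (intro fps_is_unit) (simp add: X_t2_def X_q2_def fps_const_power)
  ultimately show "qpoch (X_t1 :: 'k series) X_q1 n dvd 1" "qpoch (X_t2 :: 'k series) X_q2 n dvd 1"
    unfolding qpoch_def by (auto intro!: prod_is_unit)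
qed

lemma qpoch2_unit: "qpoch2 (c * X_u :: 'k::idom series) p q n m dvd 1"
proof -
  have "1 - c * X_u * p ^ i * q ^ j dvd (1 :: 'k series)" for i j
    by (rule fps_is_unit) (simp add: X_u_def)
  then show ?thesis
    unfolding qpoch2_def by (intro prod_is_unit)
qed

text \<open>
  Colored integers $x^c$ are pairs $(x, c)$; the color $0$ means uncolored.
\<close>

type_synonym colored = "int \<times> nat"

fun cless :: "colored \<Rightarrow> colored \<Rightarrow> bool" where
  "cless (x, c) (y, d) \<longleftrightarrow>
     (if c = 0 \<and> d = 0 then x < y
      else if c = 0 then False
      else if d = 0 then True
      else x > y \<or> x = y \<and> c > d)"

text \<open>
  A colored permutation of $\{1,\dots,n\}$ is a pair $(c, \sigma)$; outside
  $\{1,\dots,n\}$ the coloring is \<^const>\<open>undefined\<close> and the permutation is the identity,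
  so that each colored permutation has exactly one representation.
\<close>

type_synonym colperm = "(nat \<Rightarrow> nat) \<times> (nat \<Rightarrow> nat)"

definition G :: "nat \<Rightarrow> nat \<Rightarrow> colperm set" where
  "G r n = {(c, \<sigma>). c \<in> {1..n} \<rightarrow>\<^sub>E {0..<r} \<and> \<sigma> permutes {1..n}}"

fun cinv :: "nat \<Rightarrow> nat \<Rightarrow> colperm \<Rightarrow> colperm" where
  "cinv r n (c, \<sigma>) =
     ((\<lambda>i\<in>{1..n}. if c (inv \<sigma> i) = 0 then 0 else r - c (inv \<sigma> i)), inv \<sigma>)"

fun letter :: "colperm \<Rightarrow> nat \<Rightarrow> colored" where
  "letter (c, \<sigma>) i = (if i = 0 then (0, 0) else (int (\<sigma> i), c i))"

definition Des_G :: "nat \<Rightarrow> colperm \<Rightarrow> nat set" where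
  "Des_G n \<gamma> = {i \<in> {0..<n}. cless (letter \<gamma> (i + 1)) (letter \<gamma> i)}"

definition des_G :: "nat \<Rightarrow> colperm \<Rightarrow> nat" where
  "des_G n \<gamma> = card (Des_G n \<gamma>)"

definition maj :: "nat \<Rightarrow> colperm \<Rightarrow> nat" where
  "maj n \<gamma> = (\<Sum>i\<in>Des_G n \<gamma>. i)"

definition col :: "nat \<Rightarrow> colperm \<Rightarrow> nat" where
  "col n \<gamma> = (\<Sum>i\<in>{1..n}. fst \<gamma> i)"

lemma cinv_in_G:
  assumes "\<gamma> \<in> G r n" "0 < r"
  shows "cinv r n \<gamma> \<in> G r n"
  using assms by (cases \<gamma>) (auto simp: G_def permutes_inv)

lemma finite_G: "finite (G r n)"
proof -
  have "G r n = ({1..n} \<rightarrow>\<^sub>E {0..<r}) \<times> {\<sigma>. \<sigma> permutes {1..n}}"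
    by (auto simp: G_def)
  then show ?thesis
    by (simp add: finite_PiE finite_permutations)
qed

unbundle no fps_syntax

end

theory Submission
  imports Defs "HOL-Library.Product_Lexorder"
begin

text \<open>
  Both sides have the same coefficient of $u^n t_1^{k_1} t_2^{k_2}$. On the left, expanding
  $t^{\mathrm{des}} q^{\mathrm{maj}} / (t;q)_{n+1}$ over the sequences
  $k = f_0 \ge f_1 \ge \dots \ge f_n \ge 0$ that are strict at descents gives triples
  $(\gamma, f, g)$, with $f$ compatible with $\gamma$ and $g$ with $\gamma^{-1}$. Such a triple is
  determined by the word of items $(f_i, g_{\sigma(i)}, c_i)$, and the words that occur are those
  that are weakly sorted in an order whose ties are exactly the items in the same cell $(x, y)$ that
  are all uncolored or all colored. Uncolored cells range over $[0,k_1] \times [0,k_2]$ and colored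
  ones over $[0,k_1) \times [0,k_2)$; in a colored cell the colors are unconstrained, so it
  contributes a geometric series with ratio $u q_1^x q_2^y \sum_{c=1}^{r-1} a^c b^{r-c}$.
\<close>

unbundle fps_syntax

subsection \<open>Sequences compatible with a descent set\<close>

text \<open>Pinning \<open>f 0\<close> to \<open>k\<close> turns a descent at position 0 into the
  bound \<open>f 1 < k\<close>, so it is treated like any other descent.\<close>

definition adm :: "nat \<Rightarrow> nat set \<Rightarrow> nat \<Rightarrow> (nat \<Rightarrow> nat) set" where
  "adm n D k = {f \<in> {0..n} \<rightarrow>\<^sub>E {0..k}. f 0 = k \<and>
     (\<forall>i<n. f (Suc i) \<le> f i \<and> (i \<in> D \<longrightarrow> f (Suc i) < f i))}"

lemma finite_adm [simp]: "finite (adm n D k)"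
  by (rule finite_subset[of _ "{0..n} \<rightarrow>\<^sub>E {0..k}"]) (auto simp: adm_def intro: finite_PiE)

text \<open>The exponent leaves out the fixed entry \<open>f 0 = k\<close>, which the power of t
  records instead.\<close>

definition admsum :: "nat \<Rightarrow> nat set \<Rightarrow> 'a::comm_ring_1 \<Rightarrow> nat \<Rightarrow> 'a" where
  "admsum n D q k = (\<Sum>f\<in>adm n D k. q ^ (\<Sum>i=1..n. f i))"

lemma adm_antimono:
  assumes "f \<in> adm n D k" "i \<le> j" "j \<le> n"
  shows "f j \<le> f i"
  using assms(2,3)
proof (induction j rule: dec_induct)
  case (step j)
  then have "f (Suc j) \<le> f j"
    using assms(1) by (auto simp: adm_def)
  with step show ?case by simp
qed simp

lemma admsum_0: "admsum 0 D q k = 1"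
proof -
  have "adm 0 D k = {\<lambda>i\<in>{0}. k}"
    by (auto simp: adm_def fun_eq_iff PiE_iff extensional_def)
  then show ?thesis
    by (simp add: admsum_def)
qed

text \<open>Subtracting \<open>m\<close> from every entry preserves all weak and strict inequalities
  and lowers each of the \<open>n\<close> counted entries by \<open>m\<close>. For
  \<open>m > k\<close> no sequence remains, since \<open>f n \<le> f 0 = k\<close>.\<close>

lemma admsum_shift:
  "(\<Sum>f | f \<in> adm n D k \<and> m \<le> f n. q ^ (\<Sum>i=1..n. f i)) =
     (if m \<le> k then q ^ (n * m) * admsum n D q (k - m) else 0)"
proof (cases "m \<le> k")
  case True
  have "(\<Sum>f | f \<in> adm n D k \<and> m \<le> f n. q ^ (\<Sum>i=1..n. f i)) =
      (\<Sum>f\<in>adm n D (k - m). q ^ (n * m) * q ^ (\<Sum>i=1..n. f i))"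
  proof (rule sum.reindex_bij_witness[where
        i = "\<lambda>f. \<lambda>i\<in>{0..n}. f i + m" and j = "\<lambda>f. \<lambda>i\<in>{0..n}. f i - m"])
    fix f assume f: "f \<in> {f \<in> adm n D k. m \<le> f n}"
    then have ge: "m \<le> f i" if "i \<le> n" for i
      using adm_antimono[of f n D k i n] that f by simp
    show "(\<lambda>i\<in>{0..n}. (\<lambda>i\<in>{0..n}. f i - m) i + m) = f"
      using f ge by (auto simp: fun_eq_iff adm_def PiE_iff extensional_def)
    have "(\<lambda>i\<in>{0..n}. f i - m) \<in> {0..n} \<rightarrow>\<^sub>E {0..k - m}"
      using f by (auto simp: adm_def PiE_iff intro!: diff_le_mono)
    moreover have "f (Suc i) - m \<le> f i - m \<and> (i \<in> D \<longrightarrow> f (Suc i) - m < f i - m)" if "i < n" for i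
      using f ge[of "Suc i"] that by (simp add: adm_def diff_le_mono diff_less_mono)
    ultimately show "(\<lambda>i\<in>{0..n}. f i - m) \<in> adm n D (k - m)"
      using f by (simp add: adm_def)
    have "(\<Sum>i=1..n. f i) = (\<Sum>i=1..n. (\<lambda>i\<in>{0..n}. f i - m) i + m)"
      using ge by (intro sum.cong) auto
    also have "\<dots> = n * m + (\<Sum>i=1..n. (\<lambda>i\<in>{0..n}. f i - m) i)"
      by (simp only: sum.distrib) simp
    finally show "q ^ (n * m) * q ^ (\<Sum>i=1..n. (\<lambda>i\<in>{0..n}. f i - m) i) = q ^ (\<Sum>i=1..n. f i)"
      by (simp add: power_add)
  next
    fix f assume f: "f \<in> adm n D (k - m)"
    show "(\<lambda>i\<in>{0..n}. (\<lambda>i\<in>{0..n}. f i + m) i - m) = f"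
      using f by (auto simp: fun_eq_iff adm_def PiE_iff extensional_def)
    show "(\<lambda>i\<in>{0..n}. f i + m) \<in> {f \<in> adm n D k. m \<le> f n}"
      using f True by (auto simp: adm_def PiE_iff le_diff_conv2)
  qed
  then show ?thesis
    using True by (simp add: admsum_def sum_distrib_left)
next
  case False
  have "f n \<le> k" if "f \<in> adm n D k" for f
    using adm_antimono[OF that, of 0 n] that by (simp add: adm_def)
  with False have "{f. f \<in> adm n D k \<and> m \<le> f n} = {}"
    by fastforce
  then show ?thesis
    using False by (simp only: sum.empty if_False)
qed

text \<open>Remove the last entry \<open>m\<close>: what remains must end at \<open>m + d\<close> or
  above, and \<open>admsum_shift\<close> evaluates that sum. The powers of \<open>q\<close> combine
  to the exponent \<open>n * d + (n + 1) * m\<close>, which leaves a convolution with a geometric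
  series.\<close>

lemma admsum_Suc:
  fixes q :: "'a::comm_ring_1" and n :: nat and D :: "nat set"
  defines "d \<equiv> (if n \<in> D then 1 else 0 :: nat)"
  shows "admsum (Suc n) D q k =
     (if d \<le> k then q ^ (n * d) * (\<Sum>m\<le>k - d. (q ^ Suc n) ^ m * admsum n D q (k - d - m)) else 0)"
proof -
  \<comment> \<open>Resetting position \<open>Suc n\<close> to \<open>undefined\<close> makes the
    truncated sequence extensional on \<open>{0..n}\<close>.\<close>
  have "admsum (Suc n) D q k =
      (\<Sum>(m, f)\<in>(SIGMA m:{..k}. {f. f \<in> adm n D k \<and> m + d \<le> f n}). q ^ m * q ^ (\<Sum>i=1..n. f i))"
    unfolding admsum_def
  proof (rule sum.reindex_bij_witness[where
        i = "\<lambda>(m, f). f(Suc n := m)" and j = "\<lambda>f. (f (Suc n), f(Suc n := undefined))"])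
    fix f assume f: "f \<in> adm (Suc n) D k"
    show "(case (f (Suc n), f(Suc n := undefined)) of (m, f) \<Rightarrow> f(Suc n := m)) = f"
      by simp
    show "(f (Suc n), f(Suc n := undefined)) \<in> (SIGMA m:{..k}. {f. f \<in> adm n D k \<and> m + d \<le> f n})"
      using f by (auto simp: adm_def PiE_iff d_def extensional_def less_Suc_eq_le Suc_le_eq)
    show "(case (f (Suc n), f(Suc n := undefined)) of (m, f) \<Rightarrow> q ^ m * q ^ (\<Sum>i=1..n. f i)) =
        q ^ (\<Sum>i=1..Suc n. f i)"
      by (simp add: power_add mult.commute)
  next
    fix z assume z: "z \<in> (SIGMA m:{..k}. {f. f \<in> adm n D k \<and> m + d \<le> f n})"
    obtain m f where [simp]: "z = (m, f)" by force
    have "f (Suc n) = undefined"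
      using z by (auto simp: adm_def PiE_iff extensional_def)
    then show "((case z of (m, f) \<Rightarrow> f(Suc n := m)) (Suc n),
        (case z of (m, f) \<Rightarrow> f(Suc n := m))(Suc n := undefined)) = z"
      by (auto simp: fun_eq_iff)
    show "(case z of (m, f) \<Rightarrow> f(Suc n := m)) \<in> adm (Suc n) D k"
      using z by (auto simp: adm_def PiE_iff d_def extensional_def less_Suc_eq split: if_splits)
  qed
  also have "\<dots> = (\<Sum>m\<le>k. q ^ m * (\<Sum>f | f \<in> adm n D k \<and> m + d \<le> f n. q ^ (\<Sum>i=1..n. f i)))"
    by (subst sum.Sigma[symmetric]) (auto simp: sum_distrib_left)
  also have "\<dots> = (\<Sum>m\<le>k. if m + d \<le> k then q ^ m * (q ^ (n * (m + d)) * admsum n D q (k - (m + d))) else 0)"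
    unfolding admsum_shift by (intro sum.cong) auto
  also have "\<dots> = (\<Sum>m\<in>{m. m + d \<le> k}. q ^ m * (q ^ (n * (m + d)) * admsum n D q (k - (m + d))))"
    by (rule sum.mono_neutral_cong_right) auto
  also have "\<dots> = (if d \<le> k then q ^ (n * d) * (\<Sum>m\<le>k - d. (q ^ Suc n) ^ m * admsum n D q (k - d - m)) else 0)"
  proof (cases "d \<le> k")
    case True
    then have "{m. m + d \<le> k} = {..k - d}" by auto
    moreover have "q ^ m * (q ^ (n * (m + d)) * x) = q ^ (n * d) * ((q ^ Suc n) ^ m * x)" for m x
      by (simp add: power_mult_distrib ring_distribs power_add ac_simps flip: power_mult)
    ultimately show ?thesis
      using True by (simp add: sum_distrib_left add.commute)
  qed (auto intro: sum.neutral)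
  finally show ?thesis .
qed

text \<open>The geometric series, in product form so that it makes sense over any commutative
  ring.\<close>

lemma fps_const_power_series_mult:
  fixes c :: "'a::comm_ring_1"
  shows "Abs_fps (\<lambda>n. c ^ n) * (1 - fps_X * fps_const c) = 1"
proof -
  have "Abs_fps (\<lambda>n. c ^ n) * (1 - fps_X * fps_const c) =
      Abs_fps (\<lambda>n. c ^ n) - fps_X * (fps_const c * Abs_fps (\<lambda>n. c ^ n))"
    by (simp add: right_diff_distrib ac_simps)
  also have "\<dots> = 1"
  proof (rule fps_ext)
    fix n
    show "(Abs_fps (\<lambda>n. c ^ n) - fps_X * (fps_const c * Abs_fps (\<lambda>n. c ^ n))) $ n = 1 $ n"
      by (cases n) simp_all
  qed
  finally show ?thesis .
qed

text \<open>This expands t^des q^maj / (t;q)_{n+1}, with \<open>fps_X\<close> as t. By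
  \<open>admsum_Suc\<close>, passing from \<open>n\<close> to \<open>Suc n\<close> multiplies the
  series by \<open>fps_X ^ d * q ^ (n * d)\<close>, the contribution of \<open>n\<close> to
  \<open>D\<close>, and divides it by the new factor of \<open>qpoch\<close>.\<close>

lemma admsum_gf:
  fixes q :: "'a::comm_ring_1"
  shows "Abs_fps (admsum n D q) * qpoch fps_X (fps_const q) (n + 1) =
     fps_X ^ card (D \<inter> {0..<n}) * fps_const q ^ \<Sum>(D \<inter> {0..<n})"
proof (induction n)
  case 0
  show ?case
    using fps_const_power_series_mult[of "1::'a"] by (simp add: admsum_0 qpoch_def)
next
  case (Suc n)
  define d where "d = (if n \<in> D then 1 else 0 :: nat)"
  \<comment> \<open>The factor \<open>fps_X ^ d\<close> accounts both for the shift to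
    \<open>k - d\<close> and for the zero case \<open>k < d\<close> of
    \<open>admsum_Suc\<close>.\<close>
  have H: "Abs_fps (admsum (Suc n) D q) =
      fps_X ^ d * (fps_const (q ^ (n * d)) * (Abs_fps (\<lambda>m. (q ^ Suc n) ^ m) * Abs_fps (admsum n D q)))"
  proof (rule fps_ext)
    fix k
    let ?R = "fps_const (q ^ (n * d)) * (Abs_fps (\<lambda>m. (q ^ Suc n) ^ m) * Abs_fps (admsum n D q))"
    have "(fps_X ^ d * ?R) $ k = (if k < d then 0 else ?R $ (k - d))"
      by (rule fps_X_power_mult_nth)
    also have "?R $ j = q ^ (n * d) * (\<Sum>m\<le>j. (q ^ Suc n) ^ m * admsum n D q (j - m))" for j
      by (simp only: fps_mult_left_const_nth) (simp only: fps_mult_nth fps_nth_Abs_fps atLeast0AtMost)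
    finally show "Abs_fps (admsum (Suc n) D q) $ k = (fps_X ^ d * ?R) $ k"
      by (simp add: admsum_Suc d_def)
  qed
  have Q: "qpoch fps_X (fps_const q) (Suc n + 1) =
      qpoch fps_X (fps_const q) (n + 1) * (1 - fps_X * fps_const (q ^ Suc n))"
    by (simp add: qpoch_def fps_const_power)
  have D: "card (D \<inter> {0..<Suc n}) = d + card (D \<inter> {0..<n})"
      "\<Sum>(D \<inter> {0..<Suc n}) = n * d + \<Sum>(D \<inter> {0..<n})"
    by (auto simp: atLeast0_lessThan_Suc d_def)
  have "Abs_fps (admsum (Suc n) D q) * qpoch fps_X (fps_const q) (Suc n + 1) =
      fps_X ^ d * fps_const (q ^ (n * d)) *
      (Abs_fps (\<lambda>m. (q ^ Suc n) ^ m) * (1 - fps_X * fps_const (q ^ Suc n))) *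
      (Abs_fps (admsum n D q) * qpoch fps_X (fps_const q) (n + 1))"
    unfolding H Q by (simp only: ac_simps)
  also have "\<dots> = fps_X ^ card (D \<inter> {0..<Suc n}) * fps_const q ^ \<Sum>(D \<inter> {0..<Suc n})"
    unfolding Suc fps_const_power_series_mult D
    by (simp add: power_add fps_const_power[symmetric] ac_simps del: fps_const_power)
  finally show ?case .
qed

subsection \<open>Sorted words\<close>

text \<open>The inequality is weak, so letters with the same key may follow each other in any
  order.\<close>

definition words :: "nat \<Rightarrow> 'b set \<Rightarrow> ('b \<Rightarrow> 'c::linorder) \<Rightarrow> (nat \<Rightarrow> 'b) set" where
  "words n I key = {w \<in> {1..n} \<rightarrow>\<^sub>E I. \<forall>i\<in>{1..n}. \<forall>j\<in>{1..n}. i < j \<longrightarrow> key (w i) \<le> key (w j)}"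

lemma finite_words: "finite I \<Longrightarrow> finite (words n I key)"
  by (rule finite_subset[of _ "{1..n} \<rightarrow>\<^sub>E I"]) (auto simp: words_def intro: finite_PiE)

definition words_sum :: "('b \<Rightarrow> 'a::comm_ring_1) \<Rightarrow> ('b \<Rightarrow> 'c::linorder) \<Rightarrow> 'b set \<Rightarrow> nat \<Rightarrow> 'a" where
  "words_sum wt key I n = (\<Sum>w\<in>words n I key. \<Prod>i=1..n. wt (w i))"

lemma words_sum_0: "words_sum wt key I 0 = 1"
proof -
  have "words 0 I key = {\<lambda>_. undefined}"
    by (auto simp: words_def)
  then show ?thesis by (simp add: words_sum_def)
qed

text \<open>Look at the last letter. If its key is below \<open>s\<close>, sortedness puts every key
  below \<open>s\<close>. If its key is \<open>s\<close>, it can be removed, and any sorted word may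
  precede it because \<open>s\<close> bounds all keys.\<close>

lemma words_sum_Suc:
  assumes fin: "finite I" and max: "\<And>z. z \<in> I \<Longrightarrow> key z \<le> s"
  shows "words_sum wt key I (Suc n) = words_sum wt key {z \<in> I. key z < s} (Suc n) +
     (\<Sum>z | z \<in> I \<and> key z = s. wt z) * words_sum wt key I n"
proof -
  let ?N = "Suc n"
  let ?L = "words ?N {z \<in> I. key z < s} key"
  let ?T = "{w \<in> words ?N I key. key (w ?N) = s}"
  have "words ?N I key \<subseteq> ?L \<union> ?T"
  proof
    fix w assume w: "w \<in> words ?N I key"
    then have I: "w ?N \<in> I" by (auto simp: words_def PiE_iff)
    show "w \<in> ?L \<union> ?T"
    proof (cases "key (w ?N) = s")
      case False
      with max[OF I] have lt: "key (w ?N) < s" by simp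
      have "key (w i) < s" if i: "i \<in> {1..?N}" for i
      proof (cases "i = ?N")
        case False
        then have "key (w i) \<le> key (w ?N)"
          using w i by (simp add: words_def)
        with lt show ?thesis by simp
      qed (use lt in simp)
      with w show ?thesis by (auto simp: words_def PiE_iff)
    qed (use w in simp)
  qed
  moreover have "?L \<union> ?T \<subseteq> words ?N I key"
    by (auto simp: words_def PiE_iff)
  ultimately have split: "words ?N I key = ?L \<union> ?T" by blast
  have disj: "?L \<inter> ?T = {}"
    by (auto simp: words_def PiE_iff)
  have "words_sum wt key I ?N = words_sum wt key {z \<in> I. key z < s} ?N +
      (\<Sum>w\<in>?T. \<Prod>i=1..?N. wt (w i))"
    unfolding words_sum_def
    by (subst split, rule sum.union_disjoint) (use disj fin in \<open>auto intro!: finite_words finite_Collect_conjI\<close>)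
  also have "(\<Sum>w\<in>?T. \<Prod>i=1..?N. wt (w i)) =
      (\<Sum>(z, w)\<in>{z \<in> I. key z = s} \<times> words n I key. wt z * (\<Prod>i=1..n. wt (w i)))"
  proof (rule sum.reindex_bij_witness[where
        i = "\<lambda>(z, w). w(?N := z)" and j = "\<lambda>w. (w ?N, w(?N := undefined))"])
    fix w assume w: "w \<in> ?T"
    show "(case (w ?N, w(?N := undefined)) of (z, w) \<Rightarrow> w(?N := z)) = w"
      by simp
    show "(w ?N, w(?N := undefined)) \<in> {z \<in> I. key z = s} \<times> words n I key"
      using w by (auto simp: words_def PiE_iff extensional_def)
    show "(case (w ?N, w(?N := undefined)) of (z, w) \<Rightarrow> wt z * (\<Prod>i=1..n. wt (w i))) =
        (\<Prod>i=1..?N. wt (w i))"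
      by (simp add: mult.commute)
  next
    fix p assume p: "p \<in> {z \<in> I. key z = s} \<times> words n I key"
    obtain z w where [simp]: "p = (z, w)" by force
    have "w ?N = undefined"
      using p by (auto simp: words_def PiE_iff extensional_def)
    then show "((case p of (z, w) \<Rightarrow> w(?N := z)) ?N,
        (case p of (z, w) \<Rightarrow> w(?N := z))(?N := undefined)) = p"
      by (auto simp: fun_eq_iff)
    have "w(?N := z) \<in> {1..?N} \<rightarrow>\<^sub>E I"
      using p by (auto simp: words_def PiE_iff extensional_def)
    moreover have "key ((w(?N := z)) i) \<le> key ((w(?N := z)) j)"
      if "i \<in> {1..?N}" "j \<in> {1..?N}" "i < j" for i j
      using p that max by (cases "j = ?N") (auto simp: words_def PiE_iff)
    ultimately show "(case p of (z, w) \<Rightarrow> w(?N := z)) \<in> ?T"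
      using p by (simp add: words_def)
  qed
  also have "\<dots> = (\<Sum>z | z \<in> I \<and> key z = s. wt z) * words_sum wt key I n"
    by (simp add: words_sum_def sum_product sum.cartesian_product)
  finally show ?thesis .
qed

text \<open>Each key contributes a geometric series in the total weight of its fibre. The induction
  peels off the largest key together with its letters. \<open>K\<close> may exceed the image of
  \<open>key\<close>: an empty fibre gives the factor 1.\<close>

lemma words_sum_gf:
  fixes wt :: "'b \<Rightarrow> 'a::comm_ring_1" and key :: "'b \<Rightarrow> 'c::linorder"
  assumes "finite K" "finite I" "key ` I \<subseteq> K"
  shows "Abs_fps (words_sum wt key I) *
     (\<Prod>s\<in>K. 1 - fps_X * fps_const (\<Sum>z | z \<in> I \<and> key z = s. wt z)) = 1"
  using assms
proof (induction K arbitrary: I rule: finite_linorder_max_induct)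
  case empty
  then have "I = {}" by simp
  have "words n I key = {}" if "n > 0" for n
    using that \<open>I = {}\<close> by (force simp: words_def PiE_iff)
  then have "words_sum wt key I n = 0" if "n > 0" for n
    using that by (simp add: words_sum_def)
  then have "Abs_fps (words_sum wt key I) = 1"
    by (auto simp: fps_eq_iff words_sum_0 fps_one_def)
  then show ?case by simp
next
  case (insert s K)
  define I' where "I' = {z \<in> I. key z < s}"
  have le: "key z \<le> s" if "z \<in> I" for z
    using insert.hyps(2) insert.prems(2) that by fastforce
  have fib: "{z. z \<in> I \<and> key z = t} = {z. z \<in> I' \<and> key z = t}" if "t \<in> K" for t
    using insert.hyps(2) that by (auto simp: I'_def)
  define B where "B = (\<Sum>z | z \<in> I \<and> key z = s. wt z)"
  have "Abs_fps (words_sum wt key I) * (1 - fps_X * fps_const B) =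
      Abs_fps (words_sum wt key I) - fps_X * (fps_const B * Abs_fps (words_sum wt key I))"
    by (simp add: right_diff_distrib ac_simps)
  \<comment> \<open>Positive coefficients are \<open>words_sum_Suc\<close>; the constant coefficient
    counts the empty word on both sides.\<close>
  also have "\<dots> = Abs_fps (words_sum wt key I')"
  proof (rule fps_ext)
    fix n
    show "(Abs_fps (words_sum wt key I) - fps_X * (fps_const B * Abs_fps (words_sum wt key I))) $ n =
        Abs_fps (words_sum wt key I') $ n"
    proof (cases n)
      case (Suc m)
      then show ?thesis
        using words_sum_Suc[OF insert.prems(1) le, where wt = wt and n = m]
        by (simp add: B_def I'_def)
    qed (simp add: words_sum_0)
  qed
  finally have "Abs_fps (words_sum wt key I) * (1 - fps_X * fps_const B) =
      Abs_fps (words_sum wt key I')" .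
  moreover have "(\<Prod>t\<in>insert s K. 1 - fps_X * fps_const (\<Sum>z | z \<in> I \<and> key z = t. wt z)) =
      (1 - fps_X * fps_const B) *
      (\<Prod>t\<in>K. 1 - fps_X * fps_const (\<Sum>z | z \<in> I' \<and> key z = t. wt z))"
    using insert.hyps by (subst prod.insert) (auto simp: B_def fib intro!: prod.cong)
  moreover have "Abs_fps (words_sum wt key I') *
      (\<Prod>t\<in>K. 1 - fps_X * fps_const (\<Sum>z | z \<in> I' \<and> key z = t. wt z)) = 1"
    by (rule insert.IH) (use insert.prems in \<open>auto simp: I'_def\<close>)
  ultimately show ?case
    by (simp add: mult.assoc flip: mult.assoc[of _ "1 - fps_X * fps_const B"])
qed

subsection \<open>Descents as order relations\<close>

text \<open>The letters of a permutation have distinct absolute values, so the tie-breaking by color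
  in \<open>cless\<close> never decides a comparison. Negating the colored letters then turns
  \<open>cless\<close> into the order of the integers.\<close>

definition signed :: "nat \<Rightarrow> nat \<Rightarrow> int" where
  "signed c x = (if c = 0 then int x else - int x)"

text \<open>The boundary letter $\gamma(0) = 0$ needs no separate case, since $\sigma$ fixes $0$.\<close>

lemma Des_G_signed:
  assumes "\<sigma> permutes {1..n}"
  shows "i \<in> Des_G n (c, \<sigma>) \<longleftrightarrow>
     i < n \<and> signed (c (Suc i)) (\<sigma> (Suc i)) < signed (c i) (\<sigma> i)"
proof -
  have 0: "\<sigma> 0 = 0"
    using permutes_not_in[OF assms] by simp
  have pos: "1 \<le> \<sigma> j" if "1 \<le> j" "j \<le> n" for j
    using permutes_in_image[OF assms, of j] that by simp
  have neq: "\<sigma> (Suc i) \<noteq> \<sigma> i"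
    using permutes_inj[OF assms] by (simp add: inj_eq)
  show ?thesis
  proof (cases "i < n")
    case True
    then have "1 \<le> \<sigma> (Suc i)" "i \<noteq> 0 \<Longrightarrow> 1 \<le> \<sigma> i"
      using pos[of "Suc i"] pos[of i] by auto
    with True neq show ?thesis
      by (cases "i = 0") (simp_all add: Des_G_def signed_def 0)
  qed (simp add: Des_G_def)
qed

lemma less_Suc_chain_iff:
  fixes h :: "nat \<Rightarrow> 'c::order"
  shows "(\<forall>i<n. h i < h (Suc i)) \<longleftrightarrow> (\<forall>j\<le>n. \<forall>i<j. h i < h j)"
proof safe
  fix i j assume h: "\<forall>i<n. h i < h (Suc i)" and "j \<le> n" "i < j"
  from \<open>i < j\<close> \<open>j \<le> n\<close> show "h i < h j"
  proof (induction j)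
    case (Suc j)
    then have "h j < h (Suc j)" using h by simp
    with Suc show ?case by (cases "i = j") (auto intro: less_trans)
  qed simp
qed auto

text \<open>Decreasing weakly, and strictly at descents, means that the pairs
  \<open>(- f i, signed letter)\<close> increase lexicographically. Transitivity extends this from
  neighbours to all \<open>i < j\<close>. Position 0 carries the pair \<open>(- k, 0)\<close>, and
  staying above it forces \<open>f i < k\<close> exactly at the colored letters, whose signed values
  are negative.\<close>

lemma adm_Des_G_iff:
  assumes perm: "\<sigma> permutes {1..n}"
  shows "f \<in> adm n (Des_G n (c, \<sigma>)) k \<longleftrightarrow>
     f \<in> {0..n} \<rightarrow>\<^sub>E {0..k} \<and> f 0 = k \<and> (\<forall>i\<in>{1..n}. c i \<noteq> 0 \<longrightarrow> f i < k) \<and>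
     (\<forall>i\<in>{1..n}. \<forall>j\<in>{1..n}. i < j \<longrightarrow>
        (- int (f i), signed (c i) (\<sigma> i)) < (- int (f j), signed (c j) (\<sigma> j)))"
proof -
  define h where "h = (\<lambda>i. (- int (f i), signed (c i) (\<sigma> i)))"
  have 0: "\<sigma> 0 = 0"
    using permutes_not_in[OF perm] by simp
  have pos: "1 \<le> \<sigma> j" if "1 \<le> j" "j \<le> n" for j
    using permutes_in_image[OF perm, of j] that by simp
  have neq: "signed (c (Suc i)) (\<sigma> (Suc i)) \<noteq> signed (c i) (\<sigma> i)" if "i < n" for i
  proof -
    have "\<sigma> (Suc i) \<noteq> \<sigma> i"
      using permutes_inj[OF perm] by (simp add: inj_eq)
    moreover have "\<sigma> (Suc i) \<noteq> 0"
      using pos[of "Suc i"] that by simp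
    ultimately show ?thesis
      by (simp add: signed_def)
  qed
  \<comment> \<open>By \<open>neq\<close>, a position that is not a descent is a strict ascent of
    the signed letters.\<close>
  have "f (Suc i) \<le> f i \<and> (i \<in> Des_G n (c, \<sigma>) \<longrightarrow> f (Suc i) < f i) \<longleftrightarrow> h i < h (Suc i)" if "i < n" for i
    using that neq[OF that] by (auto simp: Des_G_signed[OF perm] h_def)
  then have "f \<in> adm n (Des_G n (c, \<sigma>)) k \<longleftrightarrow>
      f \<in> {0..n} \<rightarrow>\<^sub>E {0..k} \<and> f 0 = k \<and> (\<forall>i<n. h i < h (Suc i))"
    unfolding adm_def by blast
  also have "(\<forall>i<n. h i < h (Suc i)) \<longleftrightarrow> (\<forall>j\<le>n. \<forall>i<j. h i < h j)"
    by (rule less_Suc_chain_iff)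
  also have "\<dots> \<longleftrightarrow> (\<forall>j\<in>{1..n}. h 0 < h j) \<and> (\<forall>i\<in>{1..n}. \<forall>j\<in>{1..n}. i < j \<longrightarrow> h i < h j)"
  proof safe
    fix i j
    assume *: "\<forall>j\<in>{1..n}. h 0 < h j" "\<forall>i\<in>{1..n}. \<forall>j\<in>{1..n}. i < j \<longrightarrow> h i < h j"
      and ij: "j \<le> n" "i < j"
    show "h i < h j"
      by (cases "i = 0") (use * ij in \<open>simp_all del: less_prod_simp\<close>)
  qed auto
  also have "f \<in> {0..n} \<rightarrow>\<^sub>E {0..k} \<and> f 0 = k \<and> \<dots> \<longleftrightarrow>
      f \<in> {0..n} \<rightarrow>\<^sub>E {0..k} \<and> f 0 = k \<and> (\<forall>i\<in>{1..n}. c i \<noteq> 0 \<longrightarrow> f i < k) \<and>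
      (\<forall>i\<in>{1..n}. \<forall>j\<in>{1..n}. i < j \<longrightarrow> h i < h j)"
  proof -
    have "h 0 < h i \<longleftrightarrow> (c i \<noteq> 0 \<longrightarrow> f i < k)"
      if "f \<in> {0..n} \<rightarrow>\<^sub>E {0..k}" "f 0 = k" "i \<in> {1..n}" for i
    proof -
      have "f i \<le> k" using that by (auto simp: PiE_iff)
      then show ?thesis
        using that pos[of i] by (auto simp: h_def signed_def 0)
    qed
    then show ?thesis by blast
  qed
  finally show ?thesis by (simp only: h_def)
qed

text \<open>This is \<open>adm_Des_G_iff\<close> for the inverse, with positions reindexed through
  \<open>\<sigma>\<close> so that both criteria speak about positions of the original permutation.
  Only the vanishing of a color matters there, and inversion preserves it.\<close>

lemma adm_Des_G_cinv_iff:
  assumes G: "(c, \<sigma>) \<in> G r n"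
  shows "g \<in> adm n (Des_G n (cinv r n (c, \<sigma>))) k \<longleftrightarrow>
     g \<in> {0..n} \<rightarrow>\<^sub>E {0..k} \<and> g 0 = k \<and> (\<forall>i\<in>{1..n}. c i \<noteq> 0 \<longrightarrow> g (\<sigma> i) < k) \<and>
     (\<forall>i\<in>{1..n}. \<forall>j\<in>{1..n}. \<sigma> i < \<sigma> j \<longrightarrow>
        (- int (g (\<sigma> i)), signed (c i) i) < (- int (g (\<sigma> j)), signed (c j) j))"
proof -
  have perm: "\<sigma> permutes {1..n}" and c: "\<And>i. i \<in> {1..n} \<Longrightarrow> c i < r"
    using G by (auto simp: G_def PiE_iff)
  define c' where "c' = fst (cinv r n (c, \<sigma>))"
  have cinv: "cinv r n (c, \<sigma>) = (c', inv \<sigma>)"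
    by (simp add: c'_def)
  \<comment> \<open>Since \<open>c i < r\<close>, the color \<open>r - c i\<close> cannot be
    0.\<close>
  have c': "c' (\<sigma> i) = 0 \<longleftrightarrow> c i = 0" if "i \<in> {1..n}" for i
    using that c[OF that] permutes_in_image[OF perm, of i] permutes_inverses[OF perm]
    by (auto simp: c'_def)
  have signed: "signed (c' (\<sigma> i)) (inv \<sigma> (\<sigma> i)) = signed (c i) i" if "i \<in> {1..n}" for i
    using c'[OF that] permutes_inverses[OF perm] by (simp add: signed_def)
  have ball: "(\<forall>j\<in>{1..n}. P j) \<longleftrightarrow> (\<forall>i\<in>{1..n}. P (\<sigma> i))" for P
  proof -
    have "(\<forall>j\<in>\<sigma> ` {1..n}. P j) \<longleftrightarrow> (\<forall>i\<in>{1..n}. P (\<sigma> i))" by blast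
    then show ?thesis by (simp only: permutes_image[OF perm])
  qed
  define R where "R i j \<longleftrightarrow>
    (- int (g i), signed (c' i) (inv \<sigma> i)) < (- int (g j), signed (c' j) (inv \<sigma> j))" for i j
  have color: "(\<forall>j\<in>{1..n}. c' j \<noteq> 0 \<longrightarrow> g j < k) \<longleftrightarrow> (\<forall>i\<in>{1..n}. c i \<noteq> 0 \<longrightarrow> g (\<sigma> i) < k)"
    by (rule trans[OF ball]) (simp add: c')
  have "(\<forall>i\<in>{1..n}. \<forall>j\<in>{1..n}. i < j \<longrightarrow> R i j) \<longleftrightarrow>
      (\<forall>i\<in>{1..n}. \<forall>j\<in>{1..n}. \<sigma> i < \<sigma> j \<longrightarrow> R (\<sigma> i) (\<sigma> j))"
    by (rule trans[OF ball], rule ball_cong[OF refl], rule ball)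
  also have "\<dots> \<longleftrightarrow> (\<forall>i\<in>{1..n}. \<forall>j\<in>{1..n}. \<sigma> i < \<sigma> j \<longrightarrow>
      (- int (g (\<sigma> i)), signed (c i) i) < (- int (g (\<sigma> j)), signed (c j) j))"
    by (intro ball_cong refl) (simp only: R_def signed)
  finally have order: "(\<forall>i\<in>{1..n}. \<forall>j\<in>{1..n}. i < j \<longrightarrow> R i j) \<longleftrightarrow> \<dots>" .
  show ?thesis
    unfolding cinv adm_Des_G_iff[OF permutes_inv[OF perm]] color order[unfolded R_def] ..
qed

text \<open>
  This recovers $\sigma$ from the word of a triple, by ranking the positions $i$ with respect to
  $(-g(\sigma(i)), \pm i)$.
\<close>

lemma ex1_perm_strict_mono:
  fixes h :: "nat \<Rightarrow> 'c::linorder"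
  assumes inj: "inj_on h {1..n}"
  shows "\<exists>!\<sigma>. \<sigma> permutes {1..n} \<and> (\<forall>i\<in>{1..n}. \<forall>j\<in>{1..n}. \<sigma> i < \<sigma> j \<longrightarrow> h i < h j)"
proof -
  \<comment> \<open>\<open>\<rho> i\<close> is the rank of \<open>h i\<close>; it is the identity
    outside \<open>{1..n}\<close>, as \<open>permutes\<close> demands.\<close>
  define \<rho> where "\<rho> = (\<lambda>i. if i \<in> {1..n} then card {j \<in> {1..n}. h j \<le> h i} else i)"
  have mono: "\<rho> i < \<rho> j" if "i \<in> {1..n}" "j \<in> {1..n}" "h i < h j" for i j
  proof -
    have "{l \<in> {1..n}. h l \<le> h i} \<subset> {l \<in> {1..n}. h l \<le> h j}"
    proof (rule psubsetI)
      show "{l \<in> {1..n}. h l \<le> h i} \<subseteq> {l \<in> {1..n}. h l \<le> h j}"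
        using that(3) by (auto intro: order_trans less_imp_le)
      have "j \<in> {l \<in> {1..n}. h l \<le> h j}" "j \<notin> {l \<in> {1..n}. h l \<le> h i}"
        using that by auto
      then show "{l \<in> {1..n}. h l \<le> h i} \<noteq> {l \<in> {1..n}. h l \<le> h j}"
        by blast
    qed
    then show ?thesis
      using that by (simp add: \<rho>_def psubset_card_mono)
  qed
  have "\<rho> ` {1..n} \<subseteq> {1..n}"
  proof safe
    fix i assume i: "i \<in> {1..n}"
    have "card {j \<in> {1..n}. h j \<le> h i} \<le> card {1..n}"
      by (rule card_mono) auto
    moreover have "card {j \<in> {1..n}. h j \<le> h i} > 0"
      using i by (auto simp: card_gt_0_iff)
    ultimately show "\<rho> i \<in> {1..n}"
      using i by (simp add: \<rho>_def)
  qed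
  moreover have "inj_on \<rho> {1..n}"
    using mono inj by (intro inj_onI) (metis inj_on_eq_iff less_irrefl neqE)
  ultimately have "bij_betw \<rho> {1..n} {1..n}"
    by (simp add: bij_betw_def endo_inj_surj)
  then have perm: "\<rho> permutes {1..n}"
    by (rule bij_imp_permutes) (auto simp: \<rho>_def)
  show ?thesis
  proof (rule ex1I[of _ \<rho>])
    show "\<rho> permutes {1..n} \<and> (\<forall>i\<in>{1..n}. \<forall>j\<in>{1..n}. \<rho> i < \<rho> j \<longrightarrow> h i < h j)"
      using perm mono inj by (metis inj_on_eq_iff less_asym less_irrefl neqE)
  next
    fix \<sigma> assume \<sigma>: "\<sigma> permutes {1..n} \<and> (\<forall>i\<in>{1..n}. \<forall>j\<in>{1..n}. \<sigma> i < \<sigma> j \<longrightarrow> h i < h j)"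
    show "\<sigma> = \<rho>"
    proof
      fix i
      show "\<sigma> i = \<rho> i"
      proof (cases "i \<in> {1..n}")
        case True
        \<comment> \<open>Hence ranking by \<open>h\<close> and ranking by \<open>\<sigma>\<close>
          agree, and the rank of \<open>\<sigma> i\<close> among \<open>{1..n}\<close> is
          \<open>\<sigma> i\<close> itself.\<close>
        have "h j \<le> h i \<longleftrightarrow> \<sigma> j \<le> \<sigma> i" if "j \<in> {1..n}" for j
          using \<sigma> True that permutes_inj[of \<sigma> "{1..n}"]
          by (metis injD leD leI less_imp_le order_refl antisym_conv1)
        then have "{j \<in> {1..n}. h j \<le> h i} = {j \<in> {1..n}. \<sigma> j \<le> \<sigma> i}"
          by blast
        then have "\<rho> i = card {j \<in> {1..n}. \<sigma> j \<le> \<sigma> i}"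
          using True by (simp add: \<rho>_def)
        also have "\<dots> = card (\<sigma> ` {j \<in> {1..n}. \<sigma> j \<le> \<sigma> i})"
          using \<sigma> permutes_inj_on[of \<sigma> "{1..n}"] by (intro card_image[symmetric]) auto
        also have "\<sigma> ` {j \<in> {1..n}. \<sigma> j \<le> \<sigma> i} = {j \<in> \<sigma> ` {1..n}. j \<le> \<sigma> i}"
          by auto
        also have "\<dots> = {1..\<sigma> i}"
          using \<sigma> True permutes_in_image[of \<sigma> "{1..n}" i] by (auto simp: permutes_image)
        finally show ?thesis by simp
      next
        case False
        then show ?thesis
          using \<sigma> by (auto simp: \<rho>_def permutes_not_in)
      qed
    qed
  qed
qed

subsection \<open>Compatible pairs of sequences as sorted words\<close>

text \<open>This removes \<open>\<sigma>\<close> from the condition on \<open>f\<close>. Along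
  increasing \<open>\<sigma>\<close> the value \<open>k - y\<close> weakly increases, with ties
  broken by signed position. For \<open>i < j\<close> a tie therefore means
  \<open>\<sigma> i < \<sigma> j\<close> if both are uncolored and
  \<open>\<sigma> j < \<sigma> i\<close> if both are colored, which is why a strict comparison
  becomes a weak one. In the mixed case the signs decide, as \<open>y < k\<close> makes the colored
  value negative.\<close>

lemma signed_less_iff_le:
  assumes mono: "\<forall>i\<in>I. \<forall>j\<in>I. \<sigma> i < \<sigma> j \<longrightarrow>
      (- int (y i), signed (c i) i) < (- int (y j), signed (c j) j)"
    and inj: "inj_on \<sigma> I" and y: "\<And>i. i \<in> I \<Longrightarrow> y i \<le> k \<and> (c i \<noteq> 0 \<longrightarrow> y i < k)"
    and ij: "i \<in> I" "j \<in> I" "i < j"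
  shows "signed (c i) (\<sigma> i) < signed (c j) (\<sigma> j) \<longleftrightarrow>
     signed (c i) (k - y i) \<le> signed (c j) (k - y j)"
proof -
  have "\<sigma> i \<noteq> \<sigma> j"
    using inj ij by (metis inj_onD less_irrefl)
  then consider "\<sigma> i < \<sigma> j" | "\<sigma> j < \<sigma> i" by linarith
  then show ?thesis
  proof cases
    case 1
    then have "(- int (y i), signed (c i) i) < (- int (y j), signed (c j) j)"
      using mono ij by blast
    then show ?thesis
      using 1 y[OF ij(1)] y[OF ij(2)] ij(3) by (auto simp: signed_def split: if_splits)
  next
    case 2
    then have "(- int (y j), signed (c j) j) < (- int (y i), signed (c i) i)"
      using mono ij by blast
    then show ?thesis
      using 2 y[OF ij(1)] y[OF ij(2)] ij(3) by (auto simp: signed_def split: if_splits)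
  qed
qed

text \<open>The strict bounds on colored items come from the boundary letter at position 0, for the
  permutation and for its inverse.\<close>

definition items :: "nat \<Rightarrow> nat \<Rightarrow> nat \<Rightarrow> (nat \<times> nat \<times> nat) set" where
  "items r k1 k2 = {(x, y, c). x \<le> k1 \<and> y \<le> k2 \<and> c < r \<and> (c \<noteq> 0 \<longrightarrow> x < k1 \<and> y < k2)}"

text \<open>
  Sorting by the key puts larger $x$ first and, for equal $x$, the colored items with $y$ increasing
  before the uncolored ones with $y$ decreasing.
\<close>

fun item_key :: "nat \<Rightarrow> nat \<times> nat \<times> nat \<Rightarrow> int \<times> int" where
  "item_key k2 (x, y, c) = (- int x, signed c (k2 - y))"

definition triples :: "nat \<Rightarrow> nat \<Rightarrow> nat \<Rightarrow> nat \<Rightarrow> (colperm \<times> (nat \<Rightarrow> nat) \<times> (nat \<Rightarrow> nat)) set" where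
  "triples r n k1 k2 =
     (SIGMA \<gamma>:G r n. adm n (Des_G n \<gamma>) k1 \<times> adm n (Des_G n (cinv r n \<gamma>)) k2)"

text \<open>Reading \<open>g\<close> at \<open>\<sigma> i\<close> indexes both sequences by the
  positions of the permutation.\<close>

fun word_of :: "nat \<Rightarrow> colperm \<times> (nat \<Rightarrow> nat) \<times> (nat \<Rightarrow> nat) \<Rightarrow> nat \<Rightarrow> nat \<times> nat \<times> nat" where
  "word_of n ((c, \<sigma>), f, g) = (\<lambda>i\<in>{1..n}. (f i, g (\<sigma> i), c i))"

text \<open>Once the order condition on \<open>g\<close> holds, \<open>signed_less_iff_le\<close>
  turns the one on \<open>f\<close> into sortedness of the word. The remaining order condition only
  says that \<open>\<sigma>\<close> ranks the positions by data contained in the word.\<close>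

lemma triples_iff:
  "((c, \<sigma>), f, g) \<in> triples r n k1 k2 \<longleftrightarrow>
     (c, \<sigma>) \<in> G r n \<and> f \<in> {0..n} \<rightarrow>\<^sub>E {0..k1} \<and> f 0 = k1 \<and> g \<in> {0..n} \<rightarrow>\<^sub>E {0..k2} \<and> g 0 = k2 \<and>
     (\<forall>i\<in>{1..n}. \<forall>j\<in>{1..n}. \<sigma> i < \<sigma> j \<longrightarrow>
        (- int (g (\<sigma> i)), signed (c i) i) < (- int (g (\<sigma> j)), signed (c j) j)) \<and>
     word_of n ((c, \<sigma>), f, g) \<in> words n (items r k1 k2) (item_key k2)"
proof (cases "(c, \<sigma>) \<in> G r n")
  case False
  then show ?thesis by (simp add: triples_def)
next
  case True
  define w where "w = word_of n ((c, \<sigma>), f, g)"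
  \<comment> \<open>\<open>base\<close> holds the conditions common to both sides;
    \<open>small\<close> holds the strict bounds at colored positions.\<close>
  define base where "base \<longleftrightarrow> f \<in> {0..n} \<rightarrow>\<^sub>E {0..k1} \<and> f 0 = k1 \<and> g \<in> {0..n} \<rightarrow>\<^sub>E {0..k2} \<and> g 0 = k2 \<and>
     (\<forall>i\<in>{1..n}. \<forall>j\<in>{1..n}. \<sigma> i < \<sigma> j \<longrightarrow>
        (- int (g (\<sigma> i)), signed (c i) i) < (- int (g (\<sigma> j)), signed (c j) j))"
  define small where "small \<longleftrightarrow> (\<forall>i\<in>{1..n}. c i \<noteq> 0 \<longrightarrow> f i < k1 \<and> g (\<sigma> i) < k2)"
  have perm: "\<sigma> permutes {1..n}" and c: "\<And>i. i \<in> {1..n} \<Longrightarrow> c i < r"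
    using True by (auto simp: G_def PiE_iff)
  have \<sigma>: "\<sigma> i \<in> {1..n}" if "i \<in> {1..n}" for i
    using permutes_in_image[OF perm] that by simp
  have le: "f i \<le> k1" "g (\<sigma> i) \<le> k2" if base "i \<in> {1..n}" for i
    using that \<sigma>[of i] by (auto simp: base_def PiE_iff)
  have w: "w i = (f i, g (\<sigma> i), c i)" if "i \<in> {1..n}" for i
    using that by (simp add: w_def)
  have "w \<in> {1..n} \<rightarrow>\<^sub>E items r k1 k2 \<longleftrightarrow> small" if base
  proof -
    have "w \<in> {1..n} \<rightarrow>\<^sub>E items r k1 k2 \<longleftrightarrow> (\<forall>i\<in>{1..n}. w i \<in> items r k1 k2)"
      by (auto simp: w_def PiE_iff)
    also have "\<dots> \<longleftrightarrow> small"
      unfolding small_def using le[OF that] c by (intro ball_cong refl) (simp add: w items_def)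
    finally show ?thesis .
  qed
  moreover have "(- int (f i), signed (c i) (\<sigma> i)) < (- int (f j), signed (c j) (\<sigma> j)) \<longleftrightarrow>
      item_key k2 (w i) \<le> item_key k2 (w j)"
    if "base" "small" "i \<in> {1..n}" "j \<in> {1..n}" "i < j" for i j
  proof -
    have "signed (c i) (\<sigma> i) < signed (c j) (\<sigma> j) \<longleftrightarrow>
        signed (c i) (k2 - g (\<sigma> i)) \<le> signed (c j) (k2 - g (\<sigma> j))"
    proof (rule signed_less_iff_le[where I = "{1..n}"])
      show "inj_on \<sigma> {1..n}"
        using permutes_inj_on[OF perm] .
      show "g (\<sigma> i) \<le> k2 \<and> (c i \<noteq> 0 \<longrightarrow> g (\<sigma> i) < k2)" if "i \<in> {1..n}" for i
        using that le[OF \<open>base\<close>] \<open>small\<close> unfolding small_def by blast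
      show "\<forall>i\<in>{1..n}. \<forall>j\<in>{1..n}. \<sigma> i < \<sigma> j \<longrightarrow>
          (- int (g (\<sigma> i)), signed (c i) i) < (- int (g (\<sigma> j)), signed (c j) j)"
        using \<open>base\<close> unfolding base_def by blast
    qed (use that in simp_all)
    then show ?thesis
      using that by (simp add: w)
  qed
  ultimately have "base \<and> small \<and> (\<forall>i\<in>{1..n}. \<forall>j\<in>{1..n}. i < j \<longrightarrow>
        (- int (f i), signed (c i) (\<sigma> i)) < (- int (f j), signed (c j) (\<sigma> j))) \<longleftrightarrow>
      base \<and> w \<in> words n (items r k1 k2) (item_key k2)"
    unfolding words_def by blast
  moreover have "((c, \<sigma>), f, g) \<in> triples r n k1 k2 \<longleftrightarrow>
      base \<and> small \<and> (\<forall>i\<in>{1..n}. \<forall>j\<in>{1..n}. i < j \<longrightarrow>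
        (- int (f i), signed (c i) (\<sigma> i)) < (- int (f j), signed (c j) (\<sigma> j)))"
    unfolding triples_def base_def small_def mem_Sigma_iff
      adm_Des_G_iff[OF perm] adm_Des_G_cinv_iff[OF True]
    using True by blast
  ultimately have "((c, \<sigma>), f, g) \<in> triples r n k1 k2 \<longleftrightarrow>
      base \<and> w \<in> words n (items r k1 k2) (item_key k2)"
    by (simp only:)
  then show ?thesis
    by (simp only: base_def w_def True conj_assoc simp_thms)
qed

text \<open>The word shows \<open>f\<close>, \<open>c\<close> and the composite of \<open>g\<close>
  with \<open>\<sigma>\<close> on \<open>{1..n}\<close>. By \<open>ex1_perm_strict_mono\<close>
  these data determine \<open>\<sigma>\<close>, hence \<open>g\<close>; the values at 0 are
  prescribed.\<close>

lemma bij_betw_word_of: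
  "bij_betw (word_of n) (triples r n k1 k2) (words n (items r k1 k2) (item_key k2))"
proof (rule bij_betw_imageI)
  have inj_h: "inj_on (\<lambda>i. (- int (y i), signed (c i) i)) {1..n}" for y c :: "nat \<Rightarrow> nat"
  proof (rule inj_onI)
    fix i j
    assume "i \<in> {1..n}" "j \<in> {1..n}" "(- int (y i), signed (c i) i) = (- int (y j), signed (c j) j)"
    then have "1 \<le> i" "1 \<le> j" "signed (c i) i = signed (c j) j" by simp_all
    then show "i = j" by (cases "c i = 0"; cases "c j = 0") (simp_all add: signed_def)
  qed
  show "inj_on (word_of n) (triples r n k1 k2)"
  proof (rule inj_onI)
    fix p p' assume p: "p \<in> triples r n k1 k2" and p': "p' \<in> triples r n k1 k2"
      and eq: "word_of n p = word_of n p'"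
    obtain c \<sigma> f g where [simp]: "p = ((c, \<sigma>), f, g)" by (metis surj_pair)
    obtain c' \<sigma>' f' g' where [simp]: "p' = ((c', \<sigma>'), f', g')" by (metis surj_pair)
    have perm: "\<sigma> permutes {1..n}" "\<sigma>' permutes {1..n}"
      using p p' by (auto simp: triples_def G_def)
    have coords: "f i = f' i" "g (\<sigma> i) = g' (\<sigma>' i)" "c i = c' i" if "i \<in> {1..n}" for i
      using fun_cong[OF eq, of i] that by auto
    have "c = c'"
    proof (rule PiE_ext)
      show "c \<in> {1..n} \<rightarrow>\<^sub>E {0..<r}" "c' \<in> {1..n} \<rightarrow>\<^sub>E {0..<r}"
        using p p' by (simp_all add: triples_def G_def)
    qed (use coords in simp)
    moreover have "f = f'"
    proof (rule PiE_ext)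
      show "f \<in> {0..n} \<rightarrow>\<^sub>E {0..k1}" "f' \<in> {0..n} \<rightarrow>\<^sub>E {0..k1}"
        using p p' by (simp_all add: triples_iff)
      fix i assume "i \<in> {0..n}"
      then show "f i = f' i"
        using coords(1)[of i] p p' by (cases "i = 0") (simp_all add: triples_iff)
    qed
    \<comment> \<open>Both permutations rank the positions by the same function, since
      \<open>coords\<close> identifies the data of the two triples.\<close>
    moreover have \<sigma>: "\<sigma> = \<sigma>'"
    proof (rule ex1E[OF ex1_perm_strict_mono[OF inj_h[of "\<lambda>i. g (\<sigma> i)" c]]])
      fix \<tau>
      assume *: "\<forall>\<rho>. \<rho> permutes {1..n} \<and> (\<forall>i\<in>{1..n}. \<forall>j\<in>{1..n}. \<rho> i < \<rho> j \<longrightarrow>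
          (- int (g (\<sigma> i)), signed (c i) i) < (- int (g (\<sigma> j)), signed (c j) j)) \<longrightarrow> \<rho> = \<tau>"
      have "\<forall>i\<in>{1..n}. \<forall>j\<in>{1..n}. \<sigma> i < \<sigma> j \<longrightarrow>
          (- int (g (\<sigma> i)), signed (c i) i) < (- int (g (\<sigma> j)), signed (c j) j)"
        using p unfolding \<open>p = _\<close> triples_iff by blast
      moreover have "\<forall>i\<in>{1..n}. \<forall>j\<in>{1..n}. \<sigma>' i < \<sigma>' j \<longrightarrow>
          (- int (g (\<sigma> i)), signed (c i) i) < (- int (g (\<sigma> j)), signed (c j) j)"
      proof (intro ballI impI)
        fix i j assume ij: "i \<in> {1..n}" "j \<in> {1..n}" "\<sigma>' i < \<sigma>' j"
        then have "(- int (g' (\<sigma>' i)), signed (c' i) i) < (- int (g' (\<sigma>' j)), signed (c' j) j)"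
          using p' unfolding \<open>p' = _\<close> triples_iff by blast
        then show "(- int (g (\<sigma> i)), signed (c i) i) < (- int (g (\<sigma> j)), signed (c j) j)"
          using ij by (simp only: coords)
      qed
      ultimately have "\<sigma> = \<tau>" "\<sigma>' = \<tau>"
        using * perm by blast+
      then show "\<sigma> = \<sigma>'" by simp
    qed
    moreover have "g = g'"
    proof (rule PiE_ext)
      show "g \<in> {0..n} \<rightarrow>\<^sub>E {0..k2}" "g' \<in> {0..n} \<rightarrow>\<^sub>E {0..k2}"
        using p p' by (simp_all add: triples_iff)
      fix j assume j: "j \<in> {0..n}"
      show "g j = g' j"
      proof (cases "j = 0")
        case True
        then show ?thesis using p p' by (simp add: triples_iff)
      next
        case False
        with j have "j \<in> {1..n}" by simp
        then have "j \<in> \<sigma> ` {1..n}"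
          by (simp only: permutes_image[OF perm(1)])
        then show ?thesis
          using coords(2) \<sigma> by auto
      qed
    qed
    ultimately show "p = p'" by simp
  qed
  show "word_of n ` triples r n k1 k2 = words n (items r k1 k2) (item_key k2)"
  proof (intro equalityI subsetI)
    fix w assume "w \<in> word_of n ` triples r n k1 k2"
    then obtain c \<sigma> f g where "w = word_of n ((c, \<sigma>), f, g)" "((c, \<sigma>), f, g) \<in> triples r n k1 k2"
      by (metis (no_types, lifting) imageE surj_pair)
    then show "w \<in> words n (items r k1 k2) (item_key k2)"
      unfolding triples_iff by blast
  next
    fix w assume w: "w \<in> words n (items r k1 k2) (item_key k2)"
    define x where "x = (\<lambda>i. fst (w i))"
    define y where "y = (\<lambda>i. fst (snd (w i)))"
    define c where "c = (\<lambda>i\<in>{1..n}. snd (snd (w i)))"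
    have wi: "w i = (x i, y i, c i)" if "i \<in> {1..n}" for i
      using that by (simp add: x_def y_def c_def)
    have item: "(x i, y i, c i) \<in> items r k1 k2" if "i \<in> {1..n}" for i
      using w that by (auto simp: words_def PiE_iff simp flip: wi)
    \<comment> \<open>Here the existence half supplies the permutation for an arbitrary sorted
      word.\<close>
    obtain \<sigma> where perm: "\<sigma> permutes {1..n}"
      and mono: "\<forall>i\<in>{1..n}. \<forall>j\<in>{1..n}. \<sigma> i < \<sigma> j \<longrightarrow>
        (- int (y i), signed (c i) i) < (- int (y j), signed (c j) j)"
      using ex1_perm_strict_mono[OF inj_h[of y c]] by blast
    have inv\<sigma>: "inv \<sigma> i \<in> {1..n}" if "i \<in> {1..n}" for i
      using permutes_in_image[OF permutes_inv[OF perm], of i] that by simp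
    have \<sigma>: "\<sigma> i \<in> {1..n}" if "i \<in> {1..n}" for i
      using permutes_in_image[OF perm, of i] that by simp
    define f where "f = (\<lambda>i\<in>{0..n}. if i = 0 then k1 else x i)"
    define g where "g = (\<lambda>j\<in>{0..n}. if j = 0 then k2 else y (inv \<sigma> j))"
    have f: "f i = x i" if "i \<in> {1..n}" for i
      using that by (simp add: f_def)
    have g: "g (\<sigma> i) = y i" if "i \<in> {1..n}" for i
      using \<sigma>[OF that] permutes_inverses[OF perm] by (simp add: g_def)
    have w_eq: "w = word_of n ((c, \<sigma>), f, g)"
    proof
      fix i
      show "w i = word_of n ((c, \<sigma>), f, g) i"
      proof (cases "i \<in> {1..n}")
        case True
        then show ?thesis using f g wi by simp
      next
        case False
        then show ?thesis using w by (auto simp: words_def PiE_iff extensional_def)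
      qed
    qed
    have "((c, \<sigma>), f, g) \<in> triples r n k1 k2"
      unfolding triples_iff
    proof (intro conjI)
      show "(c, \<sigma>) \<in> G r n"
        using perm item by (auto simp: G_def c_def items_def)
      show "f \<in> {0..n} \<rightarrow>\<^sub>E {0..k1}"
        using item by (auto simp: f_def items_def)
      show "g \<in> {0..n} \<rightarrow>\<^sub>E {0..k2}"
        using item[OF inv\<sigma>] by (auto simp: g_def items_def)
      show "\<forall>i\<in>{1..n}. \<forall>j\<in>{1..n}. \<sigma> i < \<sigma> j \<longrightarrow>
          (- int (g (\<sigma> i)), signed (c i) i) < (- int (g (\<sigma> j)), signed (c j) j)"
      proof (intro ballI impI)
        fix i j assume ij: "i \<in> {1..n}" "j \<in> {1..n}" "\<sigma> i < \<sigma> j"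
        then have "(- int (y i), signed (c i) i) < (- int (y j), signed (c j) j)"
          using mono by blast
        then show "(- int (g (\<sigma> i)), signed (c i) i) < (- int (g (\<sigma> j)), signed (c j) j)"
          using ij by (simp only: g)
      qed
    qed (use w w_eq in \<open>simp_all add: f_def g_def\<close>)
    then show "w \<in> word_of n ` triples r n k1 k2"
      using w_eq by blast
  qed
qed

subsection \<open>The generating functions\<close>

text \<open>The exponent of \<open>b\<close> is the color that the letter receives in the
  inverse.\<close>

fun item_wt :: "nat \<Rightarrow> 'a::comm_ring_1 \<Rightarrow> 'a \<Rightarrow> 'a \<Rightarrow> 'a \<Rightarrow> nat \<times> nat \<times> nat \<Rightarrow> 'a" where
  "item_wt r q1 q2 a b (x, y, c) =
     q1 ^ x * q2 ^ y * (a ^ c * b ^ (if c = 0 then 0 else r - c))"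

text \<open>This will be the common coefficient of u^n t1^k1 t2^k2 on both sides of the
  theorem.\<close>

definition biadm_sum :: "nat \<Rightarrow> nat \<Rightarrow> nat \<Rightarrow> nat \<Rightarrow> 'a::comm_ring_1 \<Rightarrow> 'a \<Rightarrow> 'a \<Rightarrow> 'a \<Rightarrow> 'a" where
  "biadm_sum r n k1 k2 q1 q2 a b = (\<Sum>\<gamma>\<in>G r n.
     a ^ col n \<gamma> * b ^ col n (cinv r n \<gamma>) *
     (admsum n (Des_G n \<gamma>) q1 k1 * admsum n (Des_G n (cinv r n \<gamma>)) q2 k2))"

text \<open>Reindexing by \<open>\<sigma>\<close> turns the sums of \<open>g\<close> and of the
  inverse colors into sums over the positions of the word.\<close>

lemma prod_item_wt_word_of:
  assumes "((c, \<sigma>), f, g) \<in> triples r n k1 k2"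
  shows "(\<Prod>i=1..n. item_wt r q1 q2 a b (word_of n ((c, \<sigma>), f, g) i)) =
     a ^ col n (c, \<sigma>) * b ^ col n (cinv r n (c, \<sigma>)) *
     (q1 ^ (\<Sum>i=1..n. f i) * q2 ^ (\<Sum>i=1..n. g i))"
proof -
  have perm: "\<sigma> permutes {1..n}"
    using assms by (auto simp: triples_def G_def)
  have "(\<Sum>i=1..n. g i) = (\<Sum>i=1..n. g (\<sigma> i))"
    using sum.permute[OF perm, of g] by (simp add: comp_def)
  moreover have "col n (cinv r n (c, \<sigma>)) = (\<Sum>i=1..n. if c i = 0 then 0 else r - c i)"
  proof -
    have "col n (cinv r n (c, \<sigma>)) = (\<Sum>i=1..n. fst (cinv r n (c, \<sigma>)) (\<sigma> i))"
      using sum.permute[OF perm, of "fst (cinv r n (c, \<sigma>))"] by (simp add: col_def comp_def)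
    also have "\<dots> = (\<Sum>i=1..n. if c i = 0 then 0 else r - c i)"
      using permutes_in_image[OF perm] permutes_inverses[OF perm] by (intro sum.cong) auto
    finally show ?thesis .
  qed
  ultimately show ?thesis
    by (simp add: col_def prod.distrib power_sum ac_simps)
qed

lemma finite_items: "finite (items r k1 k2)"
  by (rule finite_subset[of _ "{..k1} \<times> {..k2} \<times> {..<r}"]) (auto simp: items_def)

lemma biadm_sum_eq_words_sum:
  "biadm_sum r n k1 k2 q1 q2 a b =
     words_sum (item_wt r q1 q2 a b) (item_key k2) (items r k1 k2) n"
proof -
  have "words_sum (item_wt r q1 q2 a b) (item_key k2) (items r k1 k2) n =
      (\<Sum>p\<in>triples r n k1 k2. \<Prod>i=1..n. item_wt r q1 q2 a b (word_of n p i))"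
    unfolding words_sum_def by (rule sum.reindex_bij_betw[OF bij_betw_word_of, symmetric])
  also have "\<dots> = (\<Sum>(\<gamma>, f, g)\<in>triples r n k1 k2. a ^ col n \<gamma> * b ^ col n (cinv r n \<gamma>) *
     (q1 ^ (\<Sum>i=1..n. f i) * q2 ^ (\<Sum>i=1..n. g i)))"
  proof (rule sum.cong[OF refl])
    fix p assume p: "p \<in> triples r n k1 k2"
    obtain c \<sigma> f g where "p = ((c, \<sigma>), f, g)" by (metis surj_pair)
    then show "(\<Prod>i=1..n. item_wt r q1 q2 a b (word_of n p i)) =
        (case p of (\<gamma>, f, g) \<Rightarrow> a ^ col n \<gamma> * b ^ col n (cinv r n \<gamma>) *
          (q1 ^ (\<Sum>i=1..n. f i) * q2 ^ (\<Sum>i=1..n. g i)))"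
      using prod_item_wt_word_of[of c \<sigma> f g] p by (simp only: prod.case)
  qed
  also have "\<dots> = biadm_sum r n k1 k2 q1 q2 a b"
    unfolding triples_def biadm_sum_def admsum_def sum_product sum.cartesian_product
    by (subst sum.Sigma[symmetric]) (simp_all add: finite_G sum_distrib_left split_def)
  finally show ?thesis ..
qed

lemma qpoch2_eq: "qpoch2 x p q n m = (\<Prod>(i, j)\<in>{..<n} \<times> {..<m}. 1 - x * p ^ i * q ^ j)"
  unfolding qpoch2_def prod.cartesian_product
  by (rule prod.reindex_bij_witness[of _ "\<lambda>(i, j). (Suc i, Suc j)" "\<lambda>(i, j). (i - 1, j - 1)"]) auto

text \<open>Uncolored items have a nonnegative second key component and colored ones a negative one,
  so an uncolored item shares its key with no other item.\<close>

lemma item_key_white: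
  assumes "x \<le> k1" "y \<le> k2" "0 < r"
  shows "{z \<in> items r k1 k2. item_key k2 z = item_key k2 (x, y, 0)} = {(x, y, 0)}"
  using assms by (auto simp: items_def signed_def split: if_splits)

text \<open>The key sees only whether a color vanishes. The color 1 merely names the fibre, which is
  empty for \<open>r = 1\<close>.\<close>

lemma item_key_colored:
  assumes "x < k1" "y < k2"
  shows "{z \<in> items r k1 k2. item_key k2 z = item_key k2 (x, y, 1)} = (\<lambda>c. (x, y, c)) ` {1..<r}"
  using assms by (auto simp: items_def signed_def split: if_splits)

text \<open>\<open>words_sum_gf\<close> is applied to the keys of all cells: the uncolored ones in
  \<open>U\<close> yield the first \<open>qpoch2\<close>, the colored ones in \<open>V\<close> the
  second, where summing over the nonzero colors gives the extra factor.\<close>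

lemma biadm_sum_gf:
  fixes q1 q2 a b :: "'a::comm_ring_1"
  assumes "0 < r"
  shows "Abs_fps (\<lambda>n. biadm_sum r n k1 k2 q1 q2 a b) *
     (qpoch2 fps_X (fps_const q1) (fps_const q2) (k1 + 1) (k2 + 1) *
      qpoch2 (fps_const (\<Sum>c=1..<r. a ^ c * b ^ (r - c)) * fps_X) (fps_const q1) (fps_const q2) k1 k2) = 1"
proof -
  define U where "U = (\<lambda>(x, y). item_key k2 (x, y, 0)) ` ({..<k1 + 1} \<times> {..<k2 + 1})"
  define V where "V = (\<lambda>(x, y). item_key k2 (x, y, 1)) ` ({..<k1} \<times> {..<k2})"
  define F where "F s = 1 - fps_X * fps_const
    (\<Sum>z | z \<in> items r k1 k2 \<and> item_key k2 z = s. item_wt r q1 q2 a b z)" for s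
  have "inj_on (\<lambda>(x, y). item_key k2 (x, y, 0)) ({..<k1 + 1} \<times> {..<k2 + 1})"
    by (auto simp: inj_on_def signed_def)
  then have U: "prod F U = (\<Prod>(x, y)\<in>{..<k1 + 1} \<times> {..<k2 + 1}. F (item_key k2 (x, y, 0)))"
    unfolding U_def by (subst prod.reindex) (simp_all add: split_def comp_def)
  also have "\<dots> = qpoch2 fps_X (fps_const q1) (fps_const q2) (k1 + 1) (k2 + 1)"
    unfolding qpoch2_eq
  proof (intro prod.cong refl, safe)
    fix x y assume "x < k1 + 1" "y < k2 + 1"
    then show "F (item_key k2 (x, y, 0)) = 1 - fps_X * fps_const q1 ^ x * fps_const q2 ^ y"
      using item_key_white[of x k1 y k2 r] assms
      by (simp add: F_def fps_const_power mult.assoc del: item_key.simps)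
  qed
  finally have U: "prod F U = \<dots>" .
  have "inj_on (\<lambda>(x, y). item_key k2 (x, y, 1)) ({..<k1} \<times> {..<k2})"
    by (auto simp: inj_on_def signed_def)
  then have "prod F V = (\<Prod>(x, y)\<in>{..<k1} \<times> {..<k2}. F (item_key k2 (x, y, 1)))"
    unfolding V_def by (subst prod.reindex) (simp_all add: split_def comp_def)
  also have "\<dots> = qpoch2 (fps_const (\<Sum>c=1..<r. a ^ c * b ^ (r - c)) * fps_X)
      (fps_const q1) (fps_const q2) k1 k2"
    unfolding qpoch2_eq
  proof (intro prod.cong refl, safe)
    fix x y assume xy: "x < k1" "y < k2"
    have "(\<Sum>z | z \<in> items r k1 k2 \<and> item_key k2 z = item_key k2 (x, y, 1). item_wt r q1 q2 a b z) =
        (\<Sum>c=1..<r. item_wt r q1 q2 a b (x, y, c))"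
      unfolding item_key_colored[OF xy] by (subst sum.reindex) (auto simp: inj_on_def)
    also have "\<dots> = q1 ^ x * q2 ^ y * (\<Sum>c=1..<r. a ^ c * b ^ (r - c))"
      by (simp add: sum_distrib_left)
    finally show "F (item_key k2 (x, y, 1)) =
        1 - fps_const (\<Sum>c=1..<r. a ^ c * b ^ (r - c)) * fps_X * fps_const q1 ^ x * fps_const q2 ^ y"
      by (simp add: F_def fps_const_power ac_simps del: item_key.simps flip: fps_const_mult)
  qed
  finally have V: "prod F V = \<dots>" .
  have "U \<inter> V = {}"
    by (auto simp: U_def V_def signed_def)
  then have "prod F (U \<union> V) = prod F U * prod F V"
    by (intro prod.union_disjoint) (auto simp: U_def V_def)
  moreover have "Abs_fps (words_sum (item_wt r q1 q2 a b) (item_key k2) (items r k1 k2)) *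
      prod F (U \<union> V) = 1"
    unfolding F_def
  proof (rule words_sum_gf)
    have "item_key k2 (x, y, c) \<in> U \<union> V" if "(x, y, c) \<in> items r k1 k2" for x y c
    proof (cases "c = 0")
      case True
      then have "item_key k2 (x, y, c) \<in> U"
        using that unfolding U_def by (intro image_eqI[of _ _ "(x, y)"]) (auto simp: items_def)
      then show ?thesis ..
    next
      case False
      then have "item_key k2 (x, y, c) \<in> V"
        using that unfolding V_def
        by (intro image_eqI[of _ _ "(x, y)"]) (auto simp: items_def signed_def)
      then show ?thesis ..
    qed
    then show "item_key k2 ` items r k1 k2 \<subseteq> U \<union> V"
      by (metis image_subsetI prod_cases3)
  qed (simp_all add: U_def V_def finite_items)
  ultimately show ?thesis
    by (simp only: U V biadm_sum_eq_words_sum eta_contract_eq)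
qed

section \<open>Constants in iterated series, and the generating function in t1 and t2\<close>

lemma fps_const_sum: "fps_const (sum f A) = (\<Sum>x\<in>A. fps_const (f x))"
  by (induction A rule: infinite_finite_induct) (simp_all flip: fps_const_add)

lemma fps_const_prod: "fps_const (prod f A) = (\<Prod>x\<in>A. fps_const (f x))"
  for f :: "'i \<Rightarrow> 'a::comm_ring_1"
  by (induction A rule: infinite_finite_induct) (simp_all flip: fps_const_mult)

lemma admsum_fps_const: "admsum n D (fps_const q) k = fps_const (admsum n D q k)"
  by (simp add: admsum_def fps_const_sum fps_const_power)

lemma biadm_sum_fps_const:
  "biadm_sum r n k1 k2 (fps_const q1) (fps_const q2) (fps_const a) (fps_const b) =
     fps_const (biadm_sum r n k1 k2 q1 q2 a b)"
  by (simp add: biadm_sum_def admsum_fps_const fps_const_sum fps_const_power)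

lemma qpoch_fps_const: "qpoch (fps_const x) (fps_const q) n = fps_const (qpoch x q n)"
  by (simp add: qpoch_def fps_const_prod fps_const_power flip: fps_const_1_eq_1 fps_const_sub)

text \<open>The outer series variable is t1 and the inner one t2. The double series splits over
  \<gamma> into products of one series in each variable, and \<open>admsum_gf\<close> evaluates each
  of them.\<close>

lemma biadm_sum_des_gf:
  fixes q1 q2 a b :: "'a::comm_ring_1"
  defines "\<kappa> \<equiv> \<lambda>x. fps_const (fps_const x) :: 'a fps fps"
  shows "Abs_fps (\<lambda>k1. Abs_fps (\<lambda>k2. biadm_sum r n k1 k2 q1 q2 a b)) *
     (qpoch fps_X (\<kappa> q1) (n + 1) * qpoch (fps_const fps_X) (\<kappa> q2) (n + 1)) =
     (\<Sum>\<gamma>\<in>G r n. fps_X ^ des_G n \<gamma> * fps_const fps_X ^ des_G n (cinv r n \<gamma>) *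
        \<kappa> q1 ^ maj n \<gamma> * \<kappa> q2 ^ maj n (cinv r n \<gamma>) *
        \<kappa> a ^ col n \<gamma> * \<kappa> b ^ col n (cinv r n \<gamma>))"
proof -
  \<comment> \<open>\<open>P \<gamma>\<close> involves only the outer variable and
    \<open>P' \<gamma>\<close> only the inner one, so the coefficients of their product are products
    of the two \<open>admsum\<close> values.\<close>
  define P where "P \<gamma> = Abs_fps (admsum n (Des_G n \<gamma>) (fps_const q1))" for \<gamma>
  define P' where "P' \<gamma> = fps_const (Abs_fps (admsum n (Des_G n (cinv r n \<gamma>)) q2))" for \<gamma>
  have Des: "Des_G n \<gamma> \<inter> {0..<n} = Des_G n \<gamma>" for \<gamma>
    by (auto simp: Des_G_def)
  have P: "P \<gamma> * qpoch fps_X (\<kappa> q1) (n + 1) = fps_X ^ des_G n \<gamma> * \<kappa> q1 ^ maj n \<gamma>" for \<gamma>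
    unfolding P_def \<kappa>_def admsum_gf Des by (simp add: des_G_def maj_def)
  have P': "P' \<gamma> * qpoch (fps_const fps_X) (\<kappa> q2) (n + 1) =
      fps_const fps_X ^ des_G n (cinv r n \<gamma>) * \<kappa> q2 ^ maj n (cinv r n \<gamma>)" for \<gamma>
    unfolding P'_def \<kappa>_def qpoch_fps_const fps_const_mult admsum_gf Des
    by (simp add: des_G_def maj_def fps_const_power)
  have "Abs_fps (\<lambda>k1. Abs_fps (\<lambda>k2. biadm_sum r n k1 k2 q1 q2 a b)) =
      (\<Sum>\<gamma>\<in>G r n. \<kappa> a ^ col n \<gamma> * \<kappa> b ^ col n (cinv r n \<gamma>) * (P \<gamma> * P' \<gamma>))"
    by (simp add: fps_eq_iff biadm_sum_def fps_sum_nth \<kappa>_def P_def P'_def admsum_fps_const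
        fps_const_power mult.assoc)
  also have "\<dots> * (qpoch fps_X (\<kappa> q1) (n + 1) * qpoch (fps_const fps_X) (\<kappa> q2) (n + 1)) =
      (\<Sum>\<gamma>\<in>G r n. \<kappa> a ^ col n \<gamma> * \<kappa> b ^ col n (cinv r n \<gamma>) *
        ((P \<gamma> * qpoch fps_X (\<kappa> q1) (n + 1)) * (P' \<gamma> * qpoch (fps_const fps_X) (\<kappa> q2) (n + 1))))"
    unfolding sum_distrib_right by (intro sum.cong refl) (simp only: ac_simps)
  finally show ?thesis
    unfolding P P' by (simp only: ac_simps)
qed

section \<open>The bracket, formal sums and the final identity\<close>

lemma bracket_eq_sum:
  fixes x y :: "'a::idom"
  assumes "x \<noteq> y"
  shows "bracket m x y = (\<Sum>i<m. y ^ (m - Suc i) * x ^ i)"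
  unfolding bracket_def
  by (rule exact_div_eqI) (use assms in \<open>simp_all add: power_diff_sumr2 mult.commute\<close>)

text \<open>This matches the factor ab[r-1] with the weight of the nonzero colors: the factor
  \<open>x * y\<close> raises both exponents of every term by one.\<close>

lemma mult_bracket_eq_sum:
  fixes x y :: "'a::idom"
  assumes "x \<noteq> y"
  shows "x * y * bracket (r - 1) x y = (\<Sum>c=1..<r. x ^ c * y ^ (r - c))"
proof -
  have "x * y * bracket (r - 1) x y = (\<Sum>i<r - 1. x ^ Suc i * y ^ (r - Suc i))"
    unfolding bracket_eq_sum[OF assms] sum_distrib_left
  proof (rule sum.cong[OF refl])
    fix i assume "i \<in> {..<r - 1}"
    then have "r - Suc i = Suc (r - 1 - Suc i)" by simp
    then show "x * y * (y ^ (r - 1 - Suc i) * x ^ i) = x ^ Suc i * y ^ (r - Suc i)"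
      by (simp add: ac_simps)
  qed
  also have "\<dots> = (\<Sum>c=1..<r. x ^ c * y ^ (r - c))"
    by (rule sum.reindex_bij_witness[of _ "\<lambda>c. c - 1" Suc]) auto
  finally show ?thesis .
qed

text \<open>Both sums of the theorem have this shape: a monomial \<open>e\<close> can occur only in
  the summand with index \<open>i e\<close>.\<close>

lemma has_formal_sumI:
  assumes "\<And>e. series_coeff S e = series_coeff (f (i e)) e"
    and "\<And>e j. j \<noteq> i e \<Longrightarrow> series_coeff (f j) e = 0"
  shows "f has_formal_sum S"
  unfolding has_formal_sum_def
proof
  fix e
  have sub: "{j. series_coeff (f j) e \<noteq> 0} \<subseteq> {i e}"
    using assms(2) by blast
  then have "(\<Sum>j | series_coeff (f j) e \<noteq> 0. series_coeff (f j) e) = (\<Sum>j\<in>{i e}. series_coeff (f j) e)"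
    by (intro sum.mono_neutral_left) auto
  with sub show "finite {j. series_coeff (f j) e \<noteq> 0} \<and>
      series_coeff S e = (\<Sum>j | series_coeff (f j) e \<noteq> 0. series_coeff (f j) e)"
    using assms(1) by (auto intro: finite_subset)
qed

theorem theorem7p1:
  fixes r :: nat
  assumes "0 < r"
  shows "\<exists>S :: 'k::idom series.
    (\<lambda>n. (X_u ^ n \<div> (qpoch X_t1 X_q1 (n + 1) * qpoch X_t2 X_q2 (n + 1))) *
          (\<Sum>\<gamma>\<in>G r n.
             X_t1 ^ des_G n \<gamma> * X_t2 ^ des_G n (cinv r n \<gamma>) *
             X_q1 ^ maj n \<gamma> * X_q2 ^ maj n (cinv r n \<gamma>) *
             X_a ^ col n \<gamma> * X_b ^ col n (cinv r n \<gamma>))) has_formal_sum S \<and>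
    (\<lambda>(k1, k2). (X_t1 ^ k1 * X_t2 ^ k2) \<div>
          (qpoch2 X_u X_q1 X_q2 (k1 + 1) (k2 + 1) *
           qpoch2 (X_a * X_b * bracket (r - 1) X_a X_b * X_u) X_q1 X_q2 k1 k2)) has_formal_sum S"
proof -
  \<comment> \<open>These are the last four indeterminates, seen in the ring left after stripping
    the layers of u, t1 and t2.\<close>
  define q1 q2 a b :: "'k fps fps fps fps"
    where "q1 = fps_X" and "q2 = fps_const fps_X" and "a = fps_const (fps_const fps_X)"
      and "b = fps_const (fps_const (fps_const fps_X))"
  note vars = q1_def q2_def a_def b_def
  define C where "C n k1 k2 = biadm_sum r n k1 k2 q1 q2 a b" for n k1 k2
  define S :: "'k series" where "S = Abs_fps (\<lambda>n. Abs_fps (\<lambda>k1. Abs_fps (\<lambda>k2. C n k1 k2)))"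

  have lhs: "(X_u ^ n \<div> (qpoch X_t1 X_q1 (n + 1) * qpoch X_t2 X_q2 (n + 1))) *
      (\<Sum>\<gamma>\<in>G r n.
         X_t1 ^ des_G n \<gamma> * X_t2 ^ des_G n (cinv r n \<gamma>) *
         X_q1 ^ maj n \<gamma> * X_q2 ^ maj n (cinv r n \<gamma>) *
         X_a ^ col n \<gamma> * X_b ^ col n (cinv r n \<gamma>)) =
      X_u ^ n * fps_const (S $ n)" (is "(_ \<div> ?Q) * ?N = _") for n
  proof -
    have "?N = fps_const (S $ n) * ?Q"
      using arg_cong[where f = fps_const, OF biadm_sum_des_gf[of r n q1 q2 a b]]
      by (simp add: S_def C_def X_t1_def X_t2_def X_q1_def X_q2_def X_a_def X_b_def vars
          qpoch_fps_const fps_const_power fps_const_sum)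
    moreover have "?Q dvd 1"
      using mult_dvd_mono[OF qpoch_unit(1) qpoch_unit(2)] by simp
    then have "(X_u ^ n \<div> ?Q) * ?Q = X_u ^ n"
      by (intro exact_div_mult) (auto intro: dvd_trans)
    ultimately show ?thesis
      by (simp only: ac_simps)
  qed
  \<comment> \<open>The summand \<open>n\<close> is exactly the part of \<open>S\<close> of degree
    \<open>n\<close> in u, so the exponent of u selects it.\<close>
  have first: "(\<lambda>n. X_u ^ n * fps_const (S $ n)) has_formal_sum S"
    by (rule has_formal_sumI[where i = fst])
      (auto simp: X_u_def fps_X_power_mult_nth)

  \<comment> \<open>\<open>M k1 k2\<close> collects the coefficients of t1^k1 t2^k2 into a series in
    u that is constant in t1 and t2; it is the inverse of the denominator.\<close>
  define M :: "nat \<Rightarrow> nat \<Rightarrow> 'k series"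
    where "M k1 k2 = Abs_fps (\<lambda>n. fps_const (fps_const (C n k1 k2)))" for k1 k2
  have rhs: "(X_t1 ^ k1 * X_t2 ^ k2) \<div>
      (qpoch2 X_u X_q1 X_q2 (k1 + 1) (k2 + 1) *
       qpoch2 (X_a * X_b * bracket (r - 1) X_a X_b * X_u) X_q1 X_q2 k1 k2) =
      X_t1 ^ k1 * X_t2 ^ k2 * M k1 k2" (is "_ \<div> ?D = _") for k1 k2
  proof -
    have "M k1 k2 * ?D = 1"
      unfolding M_def C_def biadm_sum_fps_const[symmetric] mult_bracket_eq_sum[OF X_a_neq_X_b]
      unfolding X_u_def X_q1_def X_q2_def X_a_def X_b_def vars
      using biadm_sum_gf[OF assms, of k1 k2 "fps_const (fps_const q1)" "fps_const (fps_const q2)"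
          "fps_const (fps_const a)" "fps_const (fps_const b)"]
      by (simp add: vars fps_const_sum fps_const_power)
    then show ?thesis
      by (intro exact_div_eqI) (auto simp: mult.assoc)
  qed
  have coeff: "(X_t1 ^ k1 * X_t2 ^ k2 * M k1 k2) $ n $ e1 $ e2 =
      (if e1 = k1 \<and> e2 = k2 then C n k1 k2 else 0)" for k1 k2 n e1 e2
    by (cases "e1 = k1"; cases "e2 = k2")
      (simp_all add: X_t1_def X_t2_def M_def fps_const_power mult.assoc)
  \<comment> \<open>Here the exponents of t1 and t2 select the summand.\<close>
  have second: "(\<lambda>(k1, k2). X_t1 ^ k1 * X_t2 ^ k2 * M k1 k2) has_formal_sum S"
    by (rule has_formal_sumI[where i = "\<lambda>(eu, et1, et2, _). (et1, et2)"])
      (auto simp: coeff S_def split: if_splits)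
  show ?thesis
    unfolding lhs rhs using first second by blast
qed

end
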